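(* Let $G=\langle\mathcal U,\preceq\rangle$ be a generation structure and let $I_G=\langle\mathcal U,\preceq,v\rangle$ be the induced intuitionistic model, where $W\in v(p)$ iff there is $k\in K_W$ with $W,k\Vvdash_G p$. Then for every $W\in\mathcal U$ and every $A\in\mathrm{Form}$: $W\Vdash_{I_G}A$ if and only if there is a $k\in K_W$ such that $W,k\Vvdash_G A$.
   Context: Formulas: $\mathrm{Var}$ is a countable set of variables; $\mathrm{Form}$ is generated from $\bot$ and $\mathrm{Var}$ by $\land,\lor,\to$; $\neg A$ abbreviates $A\to\bot$. An intuitionistic frame is a nonempty partially ordered set; all frames are rooted and tree-like (there is a least element, and for each element the set of elements below it is a finite chain). An intuitionistic model $\langle K,\le,v\rangle$ adds $v:\mathrm{Var}\to\mathcal P(K)$ with each $v(p)$ closed upwards; $\Vdash_I$ denotes the usual intuitionistic Kripke forcing relation of an intuitionistic model $I$. A finite strict finitistic model is an intuitionistic model $W=\langle K_W,\le_W,v_W\rangle$ with $K_W$ finite such that for each $k\in K_W$ the set $\{p: k\in v_W(p)\}$ is finite, and for every $p$, if $v_W(p)\ne\emptyset$ then for every $l\in K_W$ there is $l'\ge_W l$ with $l'\in v_W(p)$. $\mathcal W_{\mathrm{fin}}$ is the class of these models. Generation structures: let $\mathcal U\subseteq\mathcal W_{\mathrm{fin}}$ be at most countable. A relation $\preceq$ on $\mathcal U$ is a generation order if $W_1\preceq W_2$ holds iff (i) $K_{W_1}\subseteq K_{W_2}$, (ii) for all $k,k'\in K_{W_1}$, $k\le_{W_1}k'$ iff $k\le_{W_2}k'$,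 and (iii) $v_{W_1}(p)\subseteq v_{W_2}(p)$ for all $p$. $\langle\mathcal U,\preceq\rangle$ is a generation structure if $\preceq$ is a generation order and $\langle\mathcal U,\preceq\rangle$ is a (rooted tree-like) intuitionistic frame. Generation forcing, for $W\in\mathcal U$, $k\in K_W$: $W,k\Vvdash_G p$ iff $k\in v_W(p)$; $W,k\not\Vvdash_G\bot$; $\land$ and $\lor$ are evaluated pointwise at $(W,k)$; $W,k\Vvdash_G A\to B$ iff for every $W'\succeq W$ and $k'\in K_{W'}$ with $k'\ge_{W'}k$, if $W',k'\Vvdash_G A$ then there is $k''\in K_{W'}$ with $k''\ge_{W'}k'$ and $W',k''\Vvdash_G B$. *)

theory Defs
  imports Main "HOL-Library.Countable_Set"
begin

datatype 'v form =
    Falsum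
  | Var 'v
  | Conj "'v form" "'v form"
  | Disj "'v form" "'v form"
  | Impl "'v form" "'v form"

abbreviation Neg :: "'v form \<Rightarrow> 'v form" where
  "Neg A \<equiv> Impl A Falsum"

record 'k frame =
  carr :: "'k set"
  le :: "('k \<times> 'k) set"

record ('k, 'v) model = "'k frame" +
  val :: "'v \<Rightarrow> 'k set"

text \<open>
  Orders and valuations are confined to the carrier (for orders this is part of
  \<^const>\<open>partial_order_on\<close>), so that two models are equal as HOL values iff they are equal as
  structures; otherwise the generation order below would fail to be antisymmetric.
\<close>

definition intuitionistic_frame :: "('k, 'z) frame_scheme \<Rightarrow> bool" where
  "intuitionistic_frame F \<longleftrightarrow>
     carr F \<noteq> {} \<and>
     partial_order_on (carr F) (le F) \<and>
     (\<exists>r\<in>carr F. \<forall>k\<in>carr F. (r, k) \<in> le F) \<and>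
     (\<forall>k\<in>carr F. finite {l. (l, k) \<in> le F} \<and> total_on {l. (l, k) \<in> le F} (le F))"

definition intuitionistic_model :: "('k, 'v) model \<Rightarrow> bool" where
  "intuitionistic_model M \<longleftrightarrow>
     intuitionistic_frame M \<and>
     (\<forall>p. val M p \<subseteq> carr M) \<and>
     (\<forall>p. \<forall>k\<in>val M p. \<forall>k'. (k, k') \<in> le M \<longrightarrow> k' \<in> val M p)"

primrec forces :: "('k, 'v) model \<Rightarrow> 'k \<Rightarrow> 'v form \<Rightarrow> bool" where
  "forces M k Falsum \<longleftrightarrow> False"
| "forces M k (Var p) \<longleftrightarrow> k \<in> val M p"
| "forces M k (Conj A B) \<longleftrightarrow> forces M k A \<and> forces M k B"
| "forces M k (Disj A B) \<longleftrightarrow> forces M k A \<or> forces M k B"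
| "forces M k (Impl A B) \<longleftrightarrow>
     (\<forall>k'\<in>carr M. (k, k') \<in> le M \<longrightarrow> forces M k' A \<longrightarrow> forces M k' B)"

definition fin_strict_finitistic_model :: "('k, 'v) model \<Rightarrow> bool" where
  "fin_strict_finitistic_model W \<longleftrightarrow>
     intuitionistic_model W \<and>
     finite (carr W) \<and>
     (\<forall>k\<in>carr W. finite {p. k \<in> val W p}) \<and>
     (\<forall>p. val W p \<noteq> {} \<longrightarrow> (\<forall>l\<in>carr W. \<exists>l'\<in>val W p. (l, l') \<in> le W))"

text \<open>
  A generation structure \<open>G\<close> is itself a frame record, whose points are models.
\<close>

definition generation_order :: "('k, 'v) model frame \<Rightarrow> bool" where
  "generation_order G \<longleftrightarrow>
     le G \<subseteq> carr G \<times> carr G \<and>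
     (\<forall>W1\<in>carr G. \<forall>W2\<in>carr G.
        (W1, W2) \<in> le G \<longleftrightarrow>
          carr W1 \<subseteq> carr W2 \<and>
          (\<forall>k\<in>carr W1. \<forall>k'\<in>carr W1. (k, k') \<in> le W1 \<longleftrightarrow> (k, k') \<in> le W2) \<and>
          (\<forall>p. val W1 p \<subseteq> val W2 p))"

definition generation_structure :: "('k, 'v) model frame \<Rightarrow> bool" where
  "generation_structure G \<longleftrightarrow>
     (\<forall>W\<in>carr G. fin_strict_finitistic_model W) \<and>
     countable (carr G) \<and>
     generation_order G \<and>
     intuitionistic_frame G"

primrec gforces :: "('k, 'v) model frame \<Rightarrow> ('k, 'v) model \<Rightarrow> 'k \<Rightarrow> 'v form \<Rightarrow> bool" where
  "gforces G W k Falsum \<longleftrightarrow> False"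
| "gforces G W k (Var p) \<longleftrightarrow> k \<in> val W p"
| "gforces G W k (Conj A B) \<longleftrightarrow> gforces G W k A \<and> gforces G W k B"
| "gforces G W k (Disj A B) \<longleftrightarrow> gforces G W k A \<or> gforces G W k B"
| "gforces G W k (Impl A B) \<longleftrightarrow>
     (\<forall>W'\<in>carr G. (W, W') \<in> le G \<longrightarrow>
        (\<forall>k'\<in>carr W'. (k, k') \<in> le W' \<longrightarrow> gforces G W' k' A \<longrightarrow>
           (\<exists>k''\<in>carr W'. (k', k'') \<in> le W' \<and> gforces G W' k'' B)))"

definition induced_model :: "('k, 'v) model frame \<Rightarrow> (('k, 'v) model, 'v) model" where
  "induced_model G =
     \<lparr>carr = carr G, le = le G,
      val = (\<lambda>p. {W \<in> carr G. \<exists>k\<in>carr W. gforces G W k (Var p)})\<rparr>"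

lemma intuitionistic_model_induced_model:
  assumes "generation_structure G"
  shows "intuitionistic_model (induced_model G)"
proof -
  have "intuitionistic_frame (induced_model G)"
    using assms
    by (simp add: generation_structure_def intuitionistic_frame_def induced_model_def)
  moreover have "W' \<in> val (induced_model G) p"
    if W: "W \<in> val (induced_model G) p" and WW': "(W, W') \<in> le (induced_model G)" for p W W'
  proof -
    have order: "generation_order G"
      using assms by (simp add: generation_structure_def)
    with WW' have "W \<in> carr G" "W' \<in> carr G"
      by (auto simp: generation_order_def induced_model_def)
    with order WW' have "carr W \<subseteq> carr W'" "val W p \<subseteq> val W' p"
      by (simp_all add: generation_order_def induced_model_def)
    with W \<open>W' \<in> carr G\<close> show ?thesis
      by (auto simp: induced_model_def)
  qed
  moreover have "val (induced_model G) p \<subseteq> carr (induced_model G)" for p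
    by (auto simp: induced_model_def)
  ultimately show ?thesis
    unfolding intuitionistic_model_def by blast
qed

end

theory Submission
  imports Defs
begin

text \<open>
  If a formula is forced somewhere in \<open>W\<close>, then it is forced densely in \<open>W\<close>: above every
  \<open>l \<in> carr W\<close> there is a point forcing it. For atoms this is the strict finitistic condition,
  and implication, whose clause asks for the consequent only above the given point, inherits it
  from its subformulas. Density makes the clauses for conjunction and implication independent of
  the point at which they are evaluated, so that ``forced at some point of \<open>W\<close>'' obeys the
  intuitionistic clauses.
\<close>

lemma fin_strict_finitistic_model_refl:
  "fin_strict_finitistic_model W \<Longrightarrow> k \<in> carr W \<Longrightarrow> (k, k) \<in> le W"
  by (auto simp: fin_strict_finitistic_model_def intuitionistic_model_def intuitionistic_frame_def
      partial_order_on_def preorder_on_def dest: refl_onD)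

lemma fin_strict_finitistic_model_trans:
  "fin_strict_finitistic_model W \<Longrightarrow> (k, l) \<in> le W \<Longrightarrow> (l, m) \<in> le W \<Longrightarrow> (k, m) \<in> le W"
  by (auto simp: fin_strict_finitistic_model_def intuitionistic_model_def intuitionistic_frame_def
      partial_order_on_def preorder_on_def dest: transD)

lemma fin_strict_finitistic_model_le_carr:
  "fin_strict_finitistic_model W \<Longrightarrow> (k, l) \<in> le W \<Longrightarrow> k \<in> carr W \<and> l \<in> carr W"
  by (auto simp: fin_strict_finitistic_model_def intuitionistic_model_def intuitionistic_frame_def
      partial_order_on_def preorder_on_def)

lemma fin_strict_finitistic_model_val_carr:
  "fin_strict_finitistic_model W \<Longrightarrow> k \<in> val W p \<Longrightarrow> k \<in> carr W"
  by (auto simp: fin_strict_finitistic_model_def intuitionistic_model_def)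

lemma fin_strict_finitistic_model_val_mono:
  "fin_strict_finitistic_model W \<Longrightarrow> k \<in> val W p \<Longrightarrow> (k, l) \<in> le W \<Longrightarrow> l \<in> val W p"
  by (auto simp: fin_strict_finitistic_model_def intuitionistic_model_def)

lemma fin_strict_finitistic_model_val_dense:
  "fin_strict_finitistic_model W \<Longrightarrow> k \<in> val W p \<Longrightarrow> l \<in> carr W \<Longrightarrow> \<exists>l'\<in>val W p. (l, l') \<in> le W"
  by (auto simp: fin_strict_finitistic_model_def)

lemma generation_structure_model:
  "generation_structure G \<Longrightarrow> W \<in> carr G \<Longrightarrow> fin_strict_finitistic_model W"
  by (simp add: generation_structure_def)

lemma generation_structure_carr_mono:
  assumes "generation_structure G" "(W, W') \<in> le G"
  shows "carr W \<subseteq> carr W'"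
proof -
  from assms have "W \<in> carr G" "W' \<in> carr G"
    by (auto simp: generation_structure_def generation_order_def)
  with assms show ?thesis
    by (simp add: generation_structure_def generation_order_def)
qed

lemma generation_structure_le_mono:
  assumes "generation_structure G" "(W, W') \<in> le G" "(k, k') \<in> le W"
  shows "(k, k') \<in> le W'"
proof -
  from assms(1,2) have W: "W \<in> carr G" "W' \<in> carr G"
    by (auto simp: generation_structure_def generation_order_def)
  moreover have "k \<in> carr W" "k' \<in> carr W"
    using fin_strict_finitistic_model_le_carr[OF generation_structure_model[OF assms(1) W(1)] assms(3)]
    by simp_all
  ultimately show ?thesis
    using assms
    by (simp add: generation_structure_def generation_order_def)
qed

text \<open>For an implication no induction hypothesis is called on: \<open>le W\<close> is
  contained in the order of every later \<open>W'\<close>, so by transitivity each point of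
  \<open>W'\<close> above \<open>k'\<close> is also above \<open>k\<close>, and the clause at
  \<open>k\<close> already covers it.\<close>

lemma gforces_mono:
  assumes "generation_structure G" "W \<in> carr G" "(k, k') \<in> le W" "gforces G W k A"
  shows "gforces G W k' A"
  using assms(3,4)
proof (induction A)
  case (Var p)
  then show ?case
    using fin_strict_finitistic_model_val_mono[OF generation_structure_model[OF assms(1,2)]] by simp
next
  case (Impl A B)
  have "(k, l) \<in> le W'" if "W' \<in> carr G" "(W, W') \<in> le G" "(k', l) \<in> le W'" for W' l
    using fin_strict_finitistic_model_trans[OF generation_structure_model[OF assms(1) that(1)]
        generation_structure_le_mono[OF assms(1) that(2) Impl.prems(1)] that(3)] .
  with Impl.prems(2) show ?case by simp
qed auto

lemma gforces_dense:
  assumes G: "generation_structure G" and "W \<in> carr G" "k \<in> carr W" "gforces G W k A" "l \<in> carr W"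
  shows "\<exists>l'\<in>carr W. (l, l') \<in> le W \<and> gforces G W l' A"
  using assms(2-)
proof (induction A arbitrary: W k l)
  case (Var p)
  have W: "fin_strict_finitistic_model W"
    using G Var.prems(1) by (rule generation_structure_model)
  then show ?case
    using fin_strict_finitistic_model_val_dense[OF W _ Var.prems(4), of k p] Var.prems(3)
      fin_strict_finitistic_model_val_carr[OF W, of _ p] by auto
next
  case (Conj A B)
  have W: "fin_strict_finitistic_model W"
    using G Conj.prems(1) by (rule generation_structure_model)
  \<comment> \<open>The two witnesses are found in sequence, the one for \<open>B\<close> above the
    one for \<open>A\<close>, so that persistence puts both conjuncts at \<open>n\<close>.\<close>
  obtain m where m: "m \<in> carr W" "(l, m) \<in> le W" "gforces G W m A"
    using Conj.IH(1)[OF Conj.prems(1,2) _ Conj.prems(4)] Conj.prems(3) by auto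
  obtain n where n: "n \<in> carr W" "(m, n) \<in> le W" "gforces G W n B"
    using Conj.IH(2)[OF Conj.prems(1,2) _ m(1)] Conj.prems(3) by auto
  have "gforces G W n A"
    using gforces_mono[OF G Conj.prems(1) n(2) m(3)] .
  then show ?case
    using n(1,3) fin_strict_finitistic_model_trans[OF W m(2) n(2)] by auto
next
  case (Disj A B)
  from Disj.prems(3) consider "gforces G W k A" | "gforces G W k B" by auto
  then show ?case
    using Disj.IH(1)[OF Disj.prems(1,2) _ Disj.prems(4)]
      Disj.IH(2)[OF Disj.prems(1,2) _ Disj.prems(4)]
    by cases auto
next
  case (Impl A B)
  \<comment> \<open>Here \<open>k'\<close> need not lie above \<open>k\<close>. Density moves
    \<open>A\<close> from \<open>k'\<close> to some \<open>m\<close> above \<open>k\<close>, the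
    implication at \<open>k\<close> yields \<open>B\<close> above \<open>m\<close>, and density
    moves \<open>B\<close> back above \<open>k'\<close>. Since \<open>l\<close> does not occur, the
    implication holds at \<open>l\<close> itself, and reflexivity finishes the case.\<close>
  have "\<exists>n\<in>carr W'. (k', n) \<in> le W' \<and> gforces G W' n B"
    if W': "W' \<in> carr G" "(W, W') \<in> le G" and k': "k' \<in> carr W'" "gforces G W' k' A" for W' k'
  proof -
    have "k \<in> carr W'"
      using generation_structure_carr_mono[OF G W'(2)] Impl.prems(2) by blast
    then obtain m where "m \<in> carr W'" "(k, m) \<in> le W'" "gforces G W' m A"
      using Impl.IH(1)[OF W'(1) k'] by blast
    then obtain n where "n \<in> carr W'" "gforces G W' n B"
      using Impl.prems(3) W' unfolding gforces.simps by blast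
    then show ?thesis
      using Impl.IH(2)[OF W'(1) _ _ k'(1)] by blast
  qed
  then have "gforces G W l (Impl A B)" by simp
  then show ?case
    using Impl.prems(4)
      fin_strict_finitistic_model_refl[OF generation_structure_model[OF G Impl.prems(1)]] by blast
qed simp

theorem proposition30:
  fixes G :: "('k, 'v :: countable) model frame"
    and W :: "('k, 'v) model"
    and A :: "'v form"
  assumes "generation_structure G"
    and "W \<in> carr G"
  shows "forces (induced_model G) W A \<longleftrightarrow> (\<exists>k\<in>carr W. gforces G W k A)"
  using assms(2)
proof (induction A arbitrary: W)
  case (Var p)
  then show ?case by (simp add: induced_model_def)
next
  case (Conj A B)
  \<comment> \<open>Density brings \<open>B\<close> to a point above \<open>k\<close>, where
    \<open>A\<close> still holds by persistence.\<close>
  have "\<exists>k\<in>carr W. gforces G W k A \<and> gforces G W k B"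
    if "k \<in> carr W" "gforces G W k A" "l \<in> carr W" "gforces G W l B" for k l
    using gforces_dense[OF assms(1) Conj.prems that(3,4,1)] that(2)
      gforces_mono[OF assms(1) Conj.prems] by blast
  then show ?case using Conj by auto
next
  case (Disj A B)
  then show ?case by auto
next
  case (Impl A B)
  note dense = gforces_dense[OF assms(1)]
  \<comment> \<open>The induction hypotheses, available at every later \<open>W'\<close>, remove
    \<open>forces\<close> from the right-hand side; what remains is a comparison of two conditions
    on \<open>gforces\<close>.\<close>
  have forces_Impl: "forces (induced_model G) W (Impl A B) \<longleftrightarrow>
      (\<forall>W'\<in>carr G. (W, W') \<in> le G \<longrightarrow>
        (\<exists>k\<in>carr W'. gforces G W' k A) \<longrightarrow> (\<exists>k\<in>carr W'. gforces G W' k B))"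
    using Impl.IH by (simp add: induced_model_def)
  show ?case
  proof
    assume "forces (induced_model G) W (Impl A B)"
    \<comment> \<open>A point of \<open>W'\<close> forcing \<open>B\<close> exists somewhere;
      density places one above the given point forcing \<open>A\<close>. The choice of
      \<open>k\<close> is irrelevant, so any element of the nonempty \<open>carr W\<close> serves as
      witness.\<close>
    then have "gforces G W k (Impl A B)" for k
      using dense unfolding forces_Impl gforces.simps by blast
    moreover have "carr W \<noteq> {}"
      using generation_structure_model[OF assms(1) Impl.prems]
      by (simp add: fin_strict_finitistic_model_def intuitionistic_model_def
          intuitionistic_frame_def)
    ultimately show "\<exists>k\<in>carr W. gforces G W k (Impl A B)" by blast
  next
    assume "\<exists>k\<in>carr W. gforces G W k (Impl A B)"
    then obtain k where k: "k \<in> carr W" "gforces G W k (Impl A B)" by blast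
    have "\<exists>n\<in>carr W'. gforces G W' n B"
      if W': "W' \<in> carr G" "(W, W') \<in> le G" and l: "l \<in> carr W'" "gforces G W' l A" for W' l
    proof -
      \<comment> \<open>The point \<open>l\<close> may be incomparable with \<open>k\<close>, so
        \<open>A\<close> is first moved above \<open>k\<close>, which density allows once
        \<open>k\<close> is known to survive in \<open>W'\<close>.\<close>
      have "k \<in> carr W'"
        using generation_structure_carr_mono[OF assms(1) W'(2)] k(1) by blast
      then obtain m where "m \<in> carr W'" "(k, m) \<in> le W'" "gforces G W' m A"
        using dense[OF W'(1) l] by blast
      then show ?thesis
        using k(2) W' unfolding gforces.simps by blast
    qed
    then show "forces (induced_model G) W (Impl A B)"
      unfolding forces_Impl by blast
  qed
qed simp

end
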